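(* For any graph $G$, $\mathsf{mtd}(G) \le 2\cdot \mathsf{td}(G) - 2$.
   Context: An elimination tree of a connected graph $G$ is a rooted tree $(T,r)$ with $r\in V(G)$ whose root-subtrees are, recursively, elimination trees of the connected components of $G - r$; its depth is the maximum number of vertices on a root-to-leaf path. The treedepth $\mathsf{td}(G)$ is the minimum depth of an elimination tree of $G$. A matched elimination tree is an elimination tree such that for every root-to-leaf path $(v_1,\dots,v_k)$: if $k$ is even, $v_1v_2, v_3v_4,\dots,v_{k-1}v_k$ are edges of $G$; if $k$ is odd, the sequence splits into consecutive blocks, all of size 2 except exactly one of size 3, where each size-2 block $(v_j,v_{j+1})$ has $v_jv_{j+1}\in E(G)$ and the size-3 block $(v_j,v_{j+1},v_{j+2})$ has $v_jv_{j+1},v_{j+1}v_{j+2}\in E(G)$. The matched treedepth $\mathsf{mtd}(G)$ is the minimum depth of a matched elimination tree. Graphs are assumed connected (for a disconnected graph both parameters are the maximum over components).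
   Formalization: The graph is assumed nonempty and without isolated vertices: the one-vertex graph has td = 1 but no matched elimination tree (a one-vertex path cannot be split into the required blocks), so mtd is undefined there and for any graph having such a component. *)

theory Defs
  imports "Graph_Theory.Digraph_Component" "HOL-Library.FSet" "HOL-Library.Extended_Nat"
begin

definition components :: "('a, 'b) pre_digraph \<Rightarrow> ('a, 'b) pre_digraph set" where
  "components G = {H. pre_digraph.max_subgraph G connected H}"

datatype 'a rtree = Node 'a "'a rtree fset"

inductive root_leaf_path :: "'a rtree \<Rightarrow> 'a list \<Rightarrow> bool" where
  leaf: "root_leaf_path (Node r {||}) [r]"
| step: "t |\<in>| ts \<Longrightarrow> root_leaf_path t p \<Longrightarrow> root_leaf_path (Node r ts) (r # p)"

definition depth :: "'a rtree \<Rightarrow> nat" where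
  "depth t = Max {length p | p. root_leaf_path t p}"

inductive elimination_tree :: "('a, 'b) pre_digraph \<Rightarrow> 'a rtree \<Rightarrow> bool" where
  "\<lbrakk>connected G; r \<in> verts G;
    bij_betw T (components (pre_digraph.del_vert G r)) (fset ts);
    \<And>C. C \<in> components (pre_digraph.del_vert G r) \<Longrightarrow> elimination_tree C (T C)\<rbrakk>
   \<Longrightarrow> elimination_tree G (Node r ts)"

definition block :: "('a, 'b) pre_digraph \<Rightarrow> nat \<Rightarrow> 'a list \<Rightarrow> bool" where
  "block G n b \<longleftrightarrow> length b = n \<and> successively (dominates G) b"

definition matched_path :: "('a, 'b) pre_digraph \<Rightarrow> 'a list \<Rightarrow> bool" where
  "matched_path G p \<longleftrightarrow>
     (if even (length p)
      then \<forall>i < length p div 2. p ! (2 * i) \<rightarrow>\<^bsub>G\<^esub> p ! (2 * i + 1)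
      else \<exists>bs b cs. p = concat bs @ b @ concat cs \<and>
             block G 3 b \<and> (\<forall>c \<in> set bs \<union> set cs. block G 2 c))"

definition matched_elimination_tree :: "('a, 'b) pre_digraph \<Rightarrow> 'a rtree \<Rightarrow> bool" where
  "matched_elimination_tree G t \<longleftrightarrow>
     elimination_tree G t \<and> (\<forall>p. root_leaf_path t p \<longrightarrow> matched_path G p)"

text \<open>
  The values lie in \<^typ>\<open>enat\<close> so that a graph without a matched elimination tree, such as
  the one-vertex graph, has matched treedepth \<open>\<infinity>\<close>: over the naturals the minimum of
  the empty set would be 0.
\<close>

definition td :: "('a, 'b) pre_digraph \<Rightarrow> enat" where
  "td G = (SUP C \<in> components G. INF t \<in> {t. elimination_tree C t}. enat (depth t))"

definition mtd :: "('a, 'b) pre_digraph \<Rightarrow> enat" where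
  "mtd G = (SUP C \<in> components G. INF t \<in> {t. matched_elimination_tree C t}. enat (depth t))"

lemma connected_arc_mono: "arc_mono connected"
  unfolding arc_mono_def
proof (intro allI impI, elim conjE)
  fix H1 H2 :: "('a, 'b) pre_digraph"
  assume "connected H1" "subgraph H1 H2" "verts H1 = verts H2"
  then show "connected H2"
    using wf_digraph.connected_spanning_imp_connected[of H2 H1]
    by (simp add: spanning_def subgraph_def)
qed

lemma components_induced:
  assumes "C \<in> components G"
  shows "induced_subgraph C G" "connected C"
  using assms pre_digraph.induced_subgraphI_arc_mono[OF _ connected_arc_mono]
    pre_digraph.max_subgraph_prop[of G connected]
  by (auto simp: components_def)

lemma components_connected:
  assumes "wf_digraph G" "connected G"
  shows "components G = {G}"
proof -
  have "subgraph G G" using assms(1) by (simp add: subgraph_def compatible_def)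
  moreover have "H = G" if "subgraph G H" "subgraph H G" for H
    using that by (auto simp: subgraph_def compatible_def intro!: pre_digraph.equality)
  ultimately show ?thesis
    using assms(2) unfolding components_def pre_digraph.max_subgraph_def
    by (intro equalityI subsetI) (auto, metis)
qed

lemma graph_induced_subgraph:
  assumes "graph G" "induced_subgraph H G"
  shows "graph H"
proof -
  interpret graph G by fact
  interpret H: wf_digraph H
    using assms(2) by (auto simp: induced_subgraph_def subgraph_def)
  have sub: "verts H \<subseteq> verts G" "arcs H \<subseteq> arcs G" "tail H = tail G" "head H = head G"
    using assms(2) unfolding induced_subgraph_def subgraph_def compatible_def by metis+
  have arcs: "arcs H = {e \<in> arcs G. tail G e \<in> verts H \<and> head G e \<in> verts H}"
    using assms(2) by (simp add: induced_subgraph_def)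
  show ?thesis
  proof unfold_locales
    show "finite (verts H)" using sub(1) finite_verts by (rule finite_subset)
    show "finite (arcs H)" using sub(2) finite_arcs by (rule finite_subset)
    show "tail H e \<noteq> head H e" if "e \<in> arcs H" for e
      using no_loops[of e] subsetD[OF sub(2) that] by (simp add: sub(3,4))
    show "e1 = e2" if "e1 \<in> arcs H" "e2 \<in> arcs H" "arc_to_ends H e1 = arc_to_ends H e2" for e1 e2
      using that sub no_multi_arcs[of e1 e2] by (auto simp: arc_to_ends_def)
    show "symmetric H"
      unfolding symmetric_conv sub(3,4)
    proof
      fix e1 assume e1: "e1 \<in> arcs H"
      then obtain e2 where "e2 \<in> arcs G" "tail G e1 = head G e2" "head G e1 = tail G e2"
        using sym_arcs sub(2) unfolding symmetric_conv by blast
      moreover from this e1 have "e2 \<in> arcs H" by (simp add: arcs)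
      ultimately show "\<exists>e2\<in>arcs H. tail G e1 = head G e2 \<and> head G e1 = tail G e2"
        by blast
    qed
  qed
qed

lemma finite_components:
  assumes "graph G"
  shows "finite (components G)"
proof -
  interpret graph G by fact
  have "components G \<subseteq> (\<lambda>S. G \<restriction> S) ` Pow (verts G)"
  proof
    fix C assume "C \<in> components G"
    then have "induced_subgraph C G" by (rule components_induced)
    then have "C = G \<restriction> verts C" "verts C \<subseteq> verts G"
      by (auto simp: induced_subgraph_def subgraph_def compatible_def induce_subgraph_def
          intro!: pre_digraph.equality)
    then show "C \<in> (\<lambda>S. G \<restriction> S) ` Pow (verts G)" by blast
  qed
  then show ?thesis by (rule finite_subset) simp
qed

lemma elimination_tree_root:
  "elimination_tree G (Node r ts) \<Longrightarrow> r \<in> verts G"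
  by (erule elimination_tree.cases) simp

lemma elimination_tree_exists:
  assumes "graph G" "connected G"
  shows "\<exists>t. elimination_tree G t"
  using assms
proof (induction "card (verts G)" arbitrary: G rule: less_induct)
  case less
  interpret graph G by fact
  obtain r where r: "r \<in> verts G"
    using less.prems(2) by (auto simp: connected_conv)
  let ?D = "pre_digraph.del_vert G r"
  have D: "induced_subgraph ?D G"
    using wf_digraph_del_vert wf_digraph
    by (auto simp: induced_subgraph_def subgraph_def compatible_def del_vert_simps)
  then have gD: "graph ?D" using less.prems(1) graph_induced_subgraph by blast
  have ex: "\<exists>t. elimination_tree C t" if C: "C \<in> components ?D" for C
  proof (rule less.hyps)
    have "verts C \<subseteq> verts ?D"
      using components_induced(1)[OF C] by (auto simp: induced_subgraph_def subgraph_def)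
    then show "card (verts C) < card (verts G)"
      using r by (intro psubset_card_mono) (auto simp: del_vert_simps)
    show "graph C" using components_induced(1)[OF C] gD graph_induced_subgraph by blast
    show "connected C" using components_induced(2)[OF C] .
  qed
  then obtain T where T: "elimination_tree C (T C)" if "C \<in> components ?D" for C
    by metis
  have inj: "inj_on T (components ?D)"
  proof (rule inj_onI)
    fix C C' assume C: "C \<in> components ?D" "C' \<in> components ?D" and eq: "T C = T C'"
    obtain s ts where s: "T C = Node s ts" by (cases "T C")
    have s_in: "s \<in> verts C" "s \<in> verts C'"
      using T[OF C(1)] T[OF C(2)] unfolding eq[symmetric] s by (simp_all add: elimination_tree_root)
    have "K \<in> pre_digraph.sccs ?D" if K: "K \<in> components ?D" for K
    proof -
      have gK: "graph K" using components_induced(1)[OF K] gD graph_induced_subgraph by blast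
      interpret K: graph K by fact
      have "strongly_connected K"
        using components_induced(2)[OF K] K.sym_arcs
        by (intro K.symmetric_connected_imp_strongly_connected)
      moreover have "connected H" if "strongly_connected H" "subgraph H ?D" for H
      proof (rule wf_digraph.connectedI)
        show "wf_digraph H" using that(2) by (simp add: subgraph_def)
        then show "u \<rightarrow>\<^sup>*\<^bsub>mk_symmetric H\<^esub> v" if "u \<in> verts H" "v \<in> verts H" for u v
          using \<open>strongly_connected H\<close> that
          by (intro wf_digraph.reachable_mk_symmetricI) (auto simp: strongly_connected_def)
        show "verts H \<noteq> {}" using that(1) by (simp add: strongly_connected_def)
      qed
      ultimately show ?thesis
        using K unfolding components_def pre_digraph.sccs_altdef2 pre_digraph.max_subgraph_def
          mem_Collect_eq
        by blast
    qed
    then show "C = C'"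
      using C s_in wf_digraph.scc_disj[of ?D C C'] wf_digraph_del_vert by blast
  qed
  have fin: "finite (T ` components ?D)" using finite_components[OF gD] by simp
  have "elimination_tree G (Node r (Abs_fset (T ` components ?D)))"
    using less.prems(2) r T inj fin
    by (intro elimination_tree.intros[where T = T])
      (auto simp: bij_betw_def Abs_fset_inverse)
  then show ?case by blast
qed

lemma td_finite:
  assumes "graph G"
  shows "td G \<noteq> \<infinity>"
proof -
  have *: "(INF t \<in> {t. elimination_tree C t}. enat (depth t)) < \<infinity>" if C: "C \<in> components G" for C
  proof -
    obtain t where "elimination_tree C t"
      using elimination_tree_exists graph_induced_subgraph[OF assms] components_induced[OF C]
      by blast
    then have "(INF t \<in> {t. elimination_tree C t}. enat (depth t)) \<le> enat (depth t)"
      by (auto intro: INF_lower)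
    also have "\<dots> < \<infinity>" by simp
    finally show ?thesis .
  qed
  have "td G < \<infinity>"
  proof (cases "components G = {}")
    case True
    then show ?thesis by (simp add: td_def bot_enat_def)
  next
    case False
    then show ?thesis
      unfolding td_def using finite_components[OF assms] *
      by (metis (mono_tags, lifting) ex_in_conv finite_imageI finite_imp_Sup_less imageE image_is_empty)
  qed
  then show ?thesis by simp
qed

end

theory Submission
  imports Defs
begin

text \<open>
  Let \<open>r\<close> be the root of an optimal elimination tree. Keep \<open>r\<close> as the root, and below it root each
  component \<open>D\<close> of \<open>G - r\<close> at a neighbour \<open>v\<close> of \<open>r\<close>. The components of \<open>D - v\<close> have smaller
  treedepth than \<open>G\<close>, so those with at least two vertices are handled recursively at the cost of the
  two additional levels \<open>r, v\<close>. A component \<open>{x}\<close> of \<open>D - v\<close> is adjacent to \<open>v\<close> since \<open>D\<close> is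
  connected, which makes \<open>(r, v, x)\<close> a block of size 3. To have the induction hypothesis available
  for the components of \<open>D - v\<close>, it is stated for all connected subgraphs of \<open>G\<close>.
\<close>

section \<open>Components and vertex deletion\<close>

lemma graph_del_vert:
  assumes "graph G"
  shows "graph (pre_digraph.del_vert G r)"
proof -
  interpret graph G by fact
  have "induced_subgraph (del_vert r) G"
    by (auto simp: induced_subgraph_def subgraph_del_vert pre_digraph.del_vert_simps)
  then show ?thesis using assms graph_induced_subgraph by blast
qed

lemma graph_component:
  assumes "graph G" "C \<in> components G"
  shows "graph C"
  using graph_induced_subgraph[OF assms(1) components_induced(1)[OF assms(2)]] .

lemma subgraph_component:
  assumes "C \<in> components G"
  shows "subgraph C G"
  using components_induced(1)[OF assms] by blast

lemma connected_verts_nonempty: "connected G \<Longrightarrow> verts G \<noteq> {}"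
  by (simp add: connected_conv)

lemma subgraph_antisym:
  assumes "subgraph G H" "subgraph H G"
  shows "G = H"
proof (rule pre_digraph.equality)
  show "verts G = verts H" "arcs G = arcs H"
    using assms by (auto simp: subgraph_def)
  show "tail G = tail H" "head G = head H"
    using assms(1) by (auto simp: subgraph_def compatible_def)
qed simp

lemma subgraph_del_vertI:
  assumes "subgraph H G" "r \<notin> verts H"
  shows "subgraph H (pre_digraph.del_vert G r)"
proof -
  interpret H: wf_digraph H using assms(1) by (simp add: subgraph_def)
  have "wf_digraph G" using assms(1) by (simp add: subgraph_def)
  then show ?thesis
    using assms H.head_in_verts H.tail_in_verts H.wf_digraph_axioms
    by (auto simp: subgraph_def compatible_def pre_digraph.del_vert_simps wf_digraph.wf_digraph_del_vert)
qed

text \<open>Connectedness refers to the symmetric closure \<open>mk_symmetric\<close>; a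
  \<open>graph\<close> has symmetric arcs, so reachability in that closure is reachability in
  \<open>G\<close> itself.\<close>

lemma reachable_if_connected_subgraph:
  assumes "graph G" "subgraph H G" "connected H" "x \<in> verts H" "y \<in> verts H"
  shows "x \<rightarrow>\<^sup>*\<^bsub>G\<^esub> y"
proof -
  interpret graph G by fact
  have "x \<rightarrow>\<^sup>*\<^bsub>mk_symmetric H\<^esub> y"
    using assms(3-5) by (auto simp: connected_def strongly_connected_def)
  then have "x \<rightarrow>\<^sup>*\<^bsub>mk_symmetric G\<^esub> y"
    using subgraph_mk_symmetric[OF assms(2)] by (rule pre_digraph.reachable_mono)
  then show ?thesis using reachable_mk_symmetric_eq sym_arcs by simp
qed

lemma subgraph_induce_reachable:
  assumes "graph G" "subgraph H G" "connected H" "x \<in> verts H"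
  shows "subgraph H (G \<restriction> {y. x \<rightarrow>\<^sup>*\<^bsub>G\<^esub> y})"
proof -
  interpret graph G by fact
  show ?thesis
    using assms(2) reachable_if_connected_subgraph[OF assms] wf_digraph.tail_in_verts[of H]
      wf_digraph.head_in_verts[of H]
    by (intro subgraphI) (auto simp: subgraph_def compatible_def wellformed_induce_subgraph)
qed

text \<open>By symmetry of the arcs, a reachability class is a strongly connected component. Any
  connected subgraph containing it stays inside the class, which gives maximality.\<close>

lemma induce_reachable_in_components:
  assumes "graph G" "x \<in> verts G"
  shows "G \<restriction> {y. x \<rightarrow>\<^sup>*\<^bsub>G\<^esub> y} \<in> components G" (is "?R \<in> _")
proof -
  interpret graph G by fact
  have scc: "?R \<in> sccs" using assms(2) by (rule induce_reachable_is_in_sccs)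
  then have sub: "subgraph ?R G" and sc: "strongly_connected ?R" by blast+
  interpret R: wf_digraph ?R using sub by (simp add: subgraph_def)
  have "connected ?R"
    using sc by (intro R.connectedI R.reachable_mk_symmetricI) (auto simp: strongly_connected_def)
  moreover have "H = ?R" if "subgraph ?R H" "subgraph H G" "connected H" for H
  proof -
    have "x \<in> verts H" using that(1) assms(2) by (auto simp: subgraph_def)
    then show ?thesis
      using subgraph_antisym subgraph_induce_reachable[OF assms(1) that(2,3)] that(1) by blast
  qed
  ultimately show ?thesis
    using sub unfolding components_def max_subgraph_def by blast
qed

text \<open>Maximality forces a component to fill the reachability class around it. Thus any single
  vertex determines its component, and components sharing a vertex coincide.\<close>

lemma component_eq_induce_reachable:
  assumes "graph G" "C \<in> components G" "x \<in> verts C"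
  shows "C = G \<restriction> {y. x \<rightarrow>\<^sup>*\<^bsub>G\<^esub> y}"
proof -
  have "x \<in> verts G" using assms subgraph_component by (auto simp: subgraph_def)
  then show ?thesis
    using assms induce_reachable_in_components[of G x] subgraph_component[OF assms(2)]
      subgraph_induce_reachable[of G C x] components_induced(2)[OF assms(2)]
      pre_digraph.max_subgraph_subg_eq[of G connected C]
    by (simp add: components_def)
qed

text \<open>Serves to place a connected subgraph that avoids the root inside the one component of
  \<open>G - r\<close> whose subtree supplies the induction hypothesis.\<close>

lemma connected_subgraph_in_component:
  assumes "graph G" "subgraph H G" "connected H"
  obtains C where "C \<in> components G" "subgraph H C"
proof -
  obtain x where x: "x \<in> verts H" using assms(3) connected_verts_nonempty by blast
  then have "x \<in> verts G" using assms(2) by (auto simp: subgraph_def)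
  then show ?thesis
    using that[OF induce_reachable_in_components subgraph_induce_reachable] x assms by blast
qed

text \<open>A walk in \<open>G\<close> from a vertex of \<open>C\<close> to \<open>r\<close> can
  leave \<open>C\<close> only by an arc into \<open>r\<close>, because every other step is also an
  arc of \<open>G - r\<close>.\<close>

lemma component_del_vert_neighbour:
  assumes "graph G" "connected G" "r \<in> verts G" "C \<in> components (pre_digraph.del_vert G r)"
  obtains v where "v \<in> verts C" "r \<rightarrow>\<^bsub>G\<^esub> v"
proof -
  interpret graph G by fact
  let ?D = "del_vert r"
  have gD: "graph ?D" using assms(1) by (rule graph_del_vert)
  interpret D: graph ?D by fact
  obtain x where x: "x \<in> verts C" using components_induced(2)[OF assms(4)] connected_verts_nonempty by blast
  have C: "C = ?D \<restriction> {y. x \<rightarrow>\<^sup>*\<^bsub>?D\<^esub> y}"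
    using component_eq_induce_reachable[OF gD assms(4) x] .
  have xG: "x \<in> verts G"
    using x subgraph_component[OF assms(4)] by (auto simp: subgraph_def pre_digraph.del_vert_simps)
  have r: "r \<notin> verts C"
    using subgraph_component[OF assms(4)] by (auto simp: subgraph_def pre_digraph.del_vert_simps)
  \<comment> \<open>Invariant along the walk: it is still in \<open>C\<close>, or a neighbour of
    \<open>r\<close> in \<open>C\<close> has been met. At \<open>y = r\<close> the first alternative
    fails.\<close>
  have "y \<in> verts C \<or> (\<exists>v \<in> verts C. v \<rightarrow>\<^bsub>G\<^esub> r)" if "x \<rightarrow>\<^sup>*\<^bsub>G\<^esub> y" for y
    using that
  proof (induction rule: reachable_induct)
    case base
    then show ?case using x by simp
  next
    case (step y z)
    have "z \<in> verts C" if "y \<in> verts C" "z \<noteq> r"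
    proof -
      have "y \<noteq> r" using that(1) r by blast
      then have "y \<rightarrow>\<^bsub>?D\<^esub> z"
        using step.hyps(2) that(2) by (auto simp: arcs_ends_conv pre_digraph.del_vert_simps)
      moreover have "x \<rightarrow>\<^sup>*\<^bsub>?D\<^esub> y" using that(1) C by (metis induce_subgraph_verts mem_Collect_eq)
      ultimately show ?thesis
        using C D.reachable_adj_trans by (metis induce_subgraph_verts mem_Collect_eq)
    qed
    then show ?case using step.IH step.hyps(2) by metis
  qed
  then have "\<exists>v \<in> verts C. v \<rightarrow>\<^bsub>G\<^esub> r"
    using r reachable_if_connected_subgraph[OF assms(1) subgraph_refl assms(2) xG assms(3)] by metis
  then show ?thesis using that graph_symmetric by metis
qed

section \<open>Rooted trees and elimination trees\<close>

lemma root_leaf_path_Node_iff: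
  "root_leaf_path (Node r ts) p \<longleftrightarrow>
     ts = {||} \<and> p = [r] \<or> (\<exists>t q. t |\<in>| ts \<and> root_leaf_path t q \<and> p = r # q)"
  by (subst root_leaf_path.simps) auto

lemma root_leaf_path_exists: "\<exists>p. root_leaf_path t p"
proof (induction t)
  case (Node r ts)
  then show ?case by (cases "ts = {||}") (auto simp: root_leaf_path_Node_iff)
qed

lemma finite_root_leaf_paths: "finite {p. root_leaf_path t p}"
proof (induction t)
  case (Node r ts)
  have "{p. root_leaf_path (Node r ts) p} \<subseteq>
      insert [r] (\<Union>t \<in> fset ts. Cons r ` {p. root_leaf_path t p})"
    by (auto simp: root_leaf_path_Node_iff)
  moreover have "finite \<dots>" using Node by auto
  ultimately show ?case by (rule finite_subset)
qed

lemma depth_le_iff: "depth t \<le> n \<longleftrightarrow> (\<forall>p. root_leaf_path t p \<longrightarrow> length p \<le> n)"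
proof -
  have "{length p | p. root_leaf_path t p} = length ` {p. root_leaf_path t p}" by auto
  then show ?thesis
    unfolding depth_def using finite_root_leaf_paths[of t] root_leaf_path_exists[of t]
    by auto
qed

lemma length_le_depth: "root_leaf_path t p \<Longrightarrow> length p \<le> depth t"
  using depth_le_iff by blast

lemma depth_pos: "0 < depth t"
proof -
  obtain p where p: "root_leaf_path t p" using root_leaf_path_exists by blast
  then have "0 < length p" by cases auto
  then show ?thesis using length_le_depth[OF p] by linarith
qed

lemma depth_subtree:
  assumes "t |\<in>| ts"
  shows "Suc (depth t) \<le> depth (Node r ts)"
proof -
  have "Suc (length p) \<le> depth (Node r ts)" if "root_leaf_path t p" for p
    using length_le_depth[OF root_leaf_path.step[OF assms that]] by simp
  \<comment> \<open>Writing the depth as \<open>Suc n\<close> turns the goal into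
    \<open>depth t \<le> n\<close>, the form required by \<open>depth_le_iff\<close>.\<close>
  moreover obtain n where n: "depth (Node r ts) = Suc n"
    using depth_pos[of "Node r ts"] by (cases "depth (Node r ts)") auto
  ultimately show ?thesis by (auto simp: depth_le_iff)
qed

text \<open>\<open>P\<close> transports conditions on paths to the subtrees. The root of a chosen
  subtree lies in its component and so identifies it; this yields the injectivity demanded by
  \<open>bij_betw\<close>.\<close>

lemma elimination_tree_Node_obtain:
  assumes "graph G" "connected G" "r \<in> verts G"
    and ex: "\<And>C. C \<in> components (pre_digraph.del_vert G r) \<Longrightarrow> \<exists>t. elimination_tree C t \<and> P t"
  obtains ts where "elimination_tree G (Node r ts)" "\<And>t. t |\<in>| ts \<Longrightarrow> P t"
proof -
  let ?D = "pre_digraph.del_vert G r"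
  have gD: "graph ?D" using assms(1) by (rule graph_del_vert)
  obtain T where T: "C \<in> components ?D \<Longrightarrow> elimination_tree C (T C) \<and> P (T C)" for C
    using ex by metis
  have "inj_on T (components ?D)"
  proof (rule inj_onI)
    fix C C' assume C: "C \<in> components ?D" "C' \<in> components ?D" and eq: "T C = T C'"
    obtain s ts where "T C = Node s ts" by (cases "T C")
    then have "s \<in> verts C" "s \<in> verts C'"
      using T[OF C(1)] T[OF C(2)] eq by (auto intro: elimination_tree_root)
    then show "C = C'"
      using component_eq_induce_reachable[OF gD C(1)] component_eq_induce_reachable[OF gD C(2)]
      by metis
  qed
  moreover have fin: "finite (T ` components ?D)" using finite_components[OF gD] by simp
  ultimately have "elimination_tree G (Node r (Abs_fset (T ` components ?D)))"
    using assms T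
    by (intro elimination_tree.intros[where T = T]) (auto simp: bij_betw_def Abs_fset_inverse)
  moreover have "P t" if "t |\<in>| Abs_fset (T ` components ?D)" for t
    using that T fin by (auto simp: Abs_fset_inverse)
  ultimately show ?thesis using that by blast
qed

lemma elimination_tree_singleton:
  assumes "connected G" "verts G = {x}"
  shows "elimination_tree G (Node x {||})"
proof -
  have "components (pre_digraph.del_vert G x) = {}"
  proof (rule ccontr)
    assume "components (pre_digraph.del_vert G x) \<noteq> {}"
    then obtain C where C: "C \<in> components (pre_digraph.del_vert G x)" by blast
    then have "verts C \<subseteq> verts (pre_digraph.del_vert G x)"
      by (rule subgraph_imp_subverts[OF subgraph_component])
    then show False
      using assms(2) components_induced(2)[OF C] connected_verts_nonempty
      by (auto simp: pre_digraph.del_vert_simps)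
  qed
  then show ?thesis
    \<comment> \<open>There are no components, so any function, even \<open>undefined\<close>, is a
      bijection between the empty sets.\<close>
    using assms by (intro elimination_tree.intros[where T = undefined]) (auto simp: bij_betw_def)
qed

text \<open>No subtrees means no components of \<open>G - r\<close>, while any remaining vertex
  would generate one through its reachability class.\<close>

lemma elimination_tree_leafD:
  assumes "elimination_tree G (Node r {||})" "graph G"
  shows "verts G = {r}"
  using assms(1)
proof cases
  case (1 T)
  have "components (pre_digraph.del_vert G r) = {}" using 1 by (simp add: bij_betw_def)
  then have "verts (pre_digraph.del_vert G r) = {}"
    using induce_reachable_in_components[OF graph_del_vert[OF assms(2)]] by blast
  then show ?thesis using 1 by (auto simp: pre_digraph.del_vert_simps)
qed

section \<open>Matched paths\<close>

lemma matched_path_pair: "a \<rightarrow>\<^bsub>G\<^esub> b \<Longrightarrow> matched_path G [a, b]"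
  by (simp add: matched_path_def)

lemma matched_path_triple:
  assumes "a \<rightarrow>\<^bsub>G\<^esub> b" "b \<rightarrow>\<^bsub>G\<^esub> c"
  shows "matched_path G [a, b, c]"
proof -
  have "[a, b, c] = concat [] @ [a, b, c] @ concat [] \<and> block G 3 [a, b, c] \<and>
      (\<forall>d \<in> set [] \<union> set []. block G 2 d)"
    using assms by (simp add: block_def)
  then have "\<exists>bs d cs. [a, b, c] = concat bs @ d @ concat cs \<and> block G 3 d \<and>
      (\<forall>e \<in> set bs \<union> set cs. block G 2 e)"
    by blast
  then show ?thesis by (simp add: matched_path_def)
qed

text \<open>Two extra vertices preserve parity and form a new first block of size 2. In the even
  case the pair indices shift by one; in the odd case \<open>[a, b]\<close> joins the blocks before
  the triple.\<close>

lemma matched_path_Cons2: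
  assumes "matched_path H p" "subgraph H G" "a \<rightarrow>\<^bsub>G\<^esub> b"
  shows "matched_path G (a # b # p)"
proof -
  have dom: "x \<rightarrow>\<^bsub>G\<^esub> y" if "x \<rightarrow>\<^bsub>H\<^esub> y" for x y
    using pre_digraph.adj_mono[OF that assms(2)] .
  have block: "block G n c" if "block H n c" for n c
    using that dom unfolding block_def by (blast intro: successively_mono)
  show ?thesis
  proof (cases "even (length p)")
    case True
    have "(a # b # p) ! (2 * i) \<rightarrow>\<^bsub>G\<^esub> (a # b # p) ! (2 * i + 1)" if "i < Suc (length p div 2)" for i
      using that assms(1,3) True dom by (cases i) (auto simp: matched_path_def)
    then show ?thesis using True by (simp add: matched_path_def)
  next
    case False
    then obtain bs c cs where p: "p = concat bs @ c @ concat cs" "block H 3 c"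
        "\<forall>d \<in> set bs \<union> set cs. block H 2 d"
      using assms(1) by (auto simp: matched_path_def)
    have "a # b # p = concat ([a, b] # bs) @ c @ concat cs \<and> block G 3 c \<and>
        (\<forall>d \<in> set ([a, b] # bs) \<union> set cs. block G 2 d)"
      using p block assms(3) by (auto simp: block_def[of G 2 "[a, b]"])
    then have "\<exists>bs d cs. a # b # p = concat bs @ d @ concat cs \<and> block G 3 d \<and>
        (\<forall>e \<in> set bs \<union> set cs. block G 2 e)"
      by blast
    then show ?thesis using False by (simp add: matched_path_def)
  qed
qed

section \<open>The bound for connected graphs\<close>

text \<open>Each level of \<open>t\<close> pays for two levels of \<open>s\<close>. One-vertex
  graphs must be excluded, since a path of length 1 is never matched.\<close>

lemma matched_elimination_tree_subgraph:
  assumes "elimination_tree G t" "graph G" "graph H" "subgraph H G" "connected H"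
    and "1 < card (verts H)"
  shows "\<exists>s. matched_elimination_tree H s \<and> depth s + 2 \<le> 2 * depth t"
  using assms
proof (induction arbitrary: H rule: elimination_tree.induct)
  case (1 G r T ts H)
  let ?d = "depth (Node r ts)"
  have elim: "elimination_tree G (Node r ts)" using "1.hyps" by (rule elimination_tree.intros)
  have gGr: "graph (pre_digraph.del_vert G r)" using \<open>graph G\<close> by (rule graph_del_vert)
  \<comment> \<open>A \<open>K\<close> avoiding \<open>r\<close> lies in one component of
    \<open>G - r\<close>, whose tree is at least one level shallower; this raises the slack from 2
    to 4, leaving room for \<open>r\<close> and \<open>v\<close>.\<close>
  have IH: "\<exists>s. matched_elimination_tree K s \<and> depth s + 4 \<le> 2 * ?d"
    if K: "graph K" "subgraph K G" "connected K" "r \<notin> verts K" "1 < card (verts K)" for K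
  proof -
    obtain C where C: "C \<in> components (pre_digraph.del_vert G r)" "subgraph K C"
      using connected_subgraph_in_component[OF gGr subgraph_del_vertI[OF K(2,4)] K(3)] .
    then obtain s where "matched_elimination_tree K s" "depth s + 2 \<le> 2 * depth (T C)"
      using "1.IH"[OF C(1) graph_component[OF gGr C(1)] K(1) C(2) K(3,5)] by blast
    moreover have "T C |\<in>| ts" using C(1) "1.hyps"(3) by (auto simp: bij_betw_def)
    then have "Suc (depth (T C)) \<le> ?d" by (rule depth_subtree)
    ultimately show ?thesis by force
  qed
  show ?case
  proof (cases "r \<in> verts H")
    case False
    then show ?thesis using IH[of H] "1.prems" by force
  next
    case rH: True
    note H = \<open>graph H\<close> \<open>connected H\<close>
    \<comment> \<open>This is the room needed for the path \<open>[r, v]\<close>, which occurs when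
      \<open>D\<close> is the single vertex \<open>v\<close>.\<close>
    have d: "2 \<le> ?d"
    proof -
      have "verts H \<noteq> {r}" using "1.prems" by auto
      then have "verts G \<noteq> {r}" using \<open>subgraph H G\<close> rH by (auto simp: subgraph_def)
      then have "ts \<noteq> {||}" using elimination_tree_leafD[of G r] elim \<open>graph G\<close> by blast
      then obtain t where "t |\<in>| ts" by auto
      then show ?thesis using depth_subtree[of t ts r] depth_pos[of t] by simp
    qed
    \<comment> \<open>The condition is imposed on full paths starting at \<open>r\<close>: the tree
      built for \<open>D\<close> need not be matched on its own.\<close>
    let ?good = "\<lambda>p. matched_path H p \<and> length p + 2 \<le> 2 * ?d"
    have "\<exists>s. elimination_tree D s \<and> (\<forall>p. root_leaf_path s p \<longrightarrow> ?good (r # p))"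
      if D: "D \<in> components (pre_digraph.del_vert H r)" for D
    proof -
      have gD: "graph D" using graph_component[OF graph_del_vert[OF H(1)] D] .
      have conD: "connected D" using D by (rule components_induced)
      have rD: "r \<notin> verts D" using subgraph_component[OF D] by (auto simp: subgraph_def pre_digraph.del_vert_simps)
      have DH: "subgraph D H"
        using subgraph_component[OF D] wf_digraph.subgraph_del_vert[of H r] \<open>subgraph H G\<close>
        by (blast intro: subgraph_trans)
      obtain v where v: "v \<in> verts D" "r \<rightarrow>\<^bsub>H\<^esub> v"
        using component_del_vert_neighbour[OF H rH D] .
      have "\<exists>s. elimination_tree E s \<and> (\<forall>p. root_leaf_path s p \<longrightarrow> ?good (r # v # p))"
        if E: "E \<in> components (pre_digraph.del_vert D v)" for E
      proof -
        have gE: "graph E" using graph_component[OF graph_del_vert[OF gD] E] .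
        have conE: "connected E" using E by (rule components_induced)
        have vE: "v \<notin> verts E" using subgraph_component[OF E] by (auto simp: subgraph_def pre_digraph.del_vert_simps)
        have ED: "subgraph E D"
          using subgraph_component[OF E] wf_digraph.subgraph_del_vert[of D v] DH
          by (blast intro: subgraph_trans)
        have EH: "subgraph E H" using ED DH subgraph_trans by blast
        interpret E: graph E by fact
        interpret D: graph D by fact
        show ?thesis
        proof (cases "1 < card (verts E)")
          case True
          moreover have "r \<notin> verts E" using ED rD by (auto simp: subgraph_def)
          ultimately obtain s where s: "matched_elimination_tree E s" "depth s + 4 \<le> 2 * ?d"
            using IH[OF gE _ conE] subgraph_trans[OF EH \<open>subgraph H G\<close>] by blast
          then show ?thesis
            using matched_path_Cons2[OF _ EH v(2)] length_le_depth[of s]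
            unfolding matched_elimination_tree_def by (intro exI[of _ s]) force
        next
          case False
          then obtain x where x: "verts E = {x}"
            using connected_verts_nonempty[OF conE] E.finite_verts
            by (metis card_0_eq card_1_singletonE less_one linorder_neqE_nat)
          obtain w where "w \<in> verts E" "v \<rightarrow>\<^bsub>D\<^esub> w"
            using component_del_vert_neighbour[OF gD conD v(1) E] .
          then have "v \<rightarrow>\<^bsub>H\<^esub> x" using x pre_digraph.adj_mono[OF _ DH] by simp
          then have m: "matched_path H [r, v, x]" by (rule matched_path_triple[OF v(2)])
          \<comment> \<open>A path of length 3 needs \<open>3 \<le> ?d\<close>. Since
            \<open>D\<close> has two vertices, the induction hypothesis applies to \<open>D\<close>
            itself; only the depth bound of the resulting tree is used, and its positive depth gives
            \<open>5 \<le> 2 * ?d\<close>.\<close>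
          have "{v, x} \<subseteq> verts D" using v(1) x ED by (auto simp: subgraph_def)
          then have "card {v, x} \<le> card (verts D)" by (rule card_mono[OF D.finite_verts])
          moreover have "v \<noteq> x" using x vE by blast
          ultimately have "1 < card (verts D)" by simp
          then obtain s where "matched_elimination_tree D s" "depth s + 4 \<le> 2 * ?d"
            using IH[OF gD _ conD rD] subgraph_trans[OF DH \<open>subgraph H G\<close>] by blast
          then have "5 \<le> 2 * ?d" using depth_pos[of s] by simp
          then show ?thesis
            using m elimination_tree_singleton[OF conE x]
            by (intro exI[of _ "Node x {||}"]) (auto simp: root_leaf_path_Node_iff)
        qed
      qed
      then obtain us where us: "elimination_tree D (Node v us)"
          "\<And>s p. s |\<in>| us \<Longrightarrow> root_leaf_path s p \<Longrightarrow> ?good (r # v # p)"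
        by (rule elimination_tree_Node_obtain[OF gD conD v(1)]) blast+
      then show ?thesis
        using matched_path_pair[OF v(2)] d
        by (intro exI[of _ "Node v us"]) (auto simp: root_leaf_path_Node_iff)
    qed
    then obtain us where us: "elimination_tree H (Node r us)"
        "\<And>s p. s |\<in>| us \<Longrightarrow> root_leaf_path s p \<Longrightarrow> ?good (r # p)"
      by (rule elimination_tree_Node_obtain[OF H rH]) blast+
    \<comment> \<open>Rules out the unmatched path \<open>[r]\<close>.\<close>
    have "us \<noteq> {||}"
      using elimination_tree_leafD[of H r] us(1) H(1) \<open>1 < card (verts H)\<close> by auto
    then have good: "?good p" if "root_leaf_path (Node r us) p" for p
      using that us(2) by (auto simp: root_leaf_path_Node_iff)
    then have "depth (Node r us) \<le> 2 * ?d - 2" unfolding depth_le_iff by force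
    then have "matched_elimination_tree H (Node r us) \<and> depth (Node r us) + 2 \<le> 2 * ?d"
      using us(1) good d by (simp add: matched_elimination_tree_def)
    then show ?thesis by blast
  qed
qed

text \<open>A neighbour of a vertex lies in the same component and, without loops, is a different
  vertex. This makes the bound for connected graphs applicable to every component.\<close>

lemma component_nontrivial:
  assumes "graph G" "\<forall>v \<in> verts G. \<exists>w. v \<rightarrow>\<^bsub>G\<^esub> w" "C \<in> components G"
  shows "1 < card (verts C)"
proof -
  interpret graph G by fact
  interpret C: graph C using assms(1,3) by (rule graph_component)
  obtain v where v: "v \<in> verts C"
    using components_induced(2)[OF assms(3)] connected_verts_nonempty by blast
  then have "v \<in> verts G" using subgraph_component[OF assms(3)] by (auto simp: subgraph_def)
  then obtain w where w: "v \<rightarrow>\<^bsub>G\<^esub> w" using assms(2) by blast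
  then have "w \<in> verts C"
    using component_eq_induce_reachable[OF assms(1,3) v]
    by (metis induce_subgraph_verts mem_Collect_eq reachable_adjI)
  then have "{v, w} \<subseteq> verts C" using v by simp
  then have "card {v, w} \<le> card (verts C)" by (rule card_mono[OF C.finite_verts])
  then show ?thesis using adj_not_same w by (cases "v = w") auto
qed

theorem theorem3:
  fixes G :: "('a, 'b) pre_digraph"
  assumes "graph G"
    and "verts G \<noteq> {}"
    and no_isolated: "\<forall>v \<in> verts G. \<exists>w. v \<rightarrow>\<^bsub>G\<^esub> w"
  shows "mtd G \<le> 2 * td G - 2"
  unfolding mtd_def
proof (rule SUP_least)
  fix C assume C: "C \<in> components G"
  have gC: "graph C" using assms(1) C by (rule graph_component)
  interpret C: graph C by fact
  have conC: "connected C" using C components_induced(2) by blast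
  let ?D = "(\<lambda>t. enat (depth t)) ` {t. elimination_tree C t}"
  have "?D \<noteq> {}" using elimination_tree_exists[OF gC conC] by blast
  \<comment> \<open>\<open>enat\<close> is well-ordered, so the infimum of a nonempty set is
    attained, here by an optimal tree.\<close>
  then have "Inf ?D \<in> ?D" by (rule wellorder_InfI[OF ex_in_conv[THEN iffD2, THEN someI_ex]])
  then obtain t where t: "elimination_tree C t" "Inf ?D = enat (depth t)" by auto
  obtain s where s: "matched_elimination_tree C s" "depth s + 2 \<le> 2 * depth t"
    using matched_elimination_tree_subgraph[OF t(1) gC gC C.subgraph_refl conC]
      component_nontrivial[OF assms(1) no_isolated C] by blast
  have "Inf ?D \<le> td G" unfolding td_def using C by (rule SUP_upper)
  then have le: "enat (depth t) \<le> td G" using t(2) by simp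
  have "(INF t \<in> {t. matched_elimination_tree C t}. enat (depth t)) \<le> enat (depth s)"
    using s(1) by (intro INF_lower) simp
  also have "\<dots> \<le> 2 * td G - 2"
  proof (cases "td G")
    case (enat n)
    \<comment> \<open>For finite \<open>td G\<close> the subtraction is the truncated one on
      naturals; it is harmless because
      \<open>depth s + 2 \<le> 2 * depth t \<le> 2 * n\<close>.\<close>
    then have "2 * td G - 2 = enat (2 * n - 2)" by (simp add: numeral_eq_enat)
    then show ?thesis using s(2) le enat by simp
  next
    case infinity
    then show ?thesis using td_finite assms(1) by blast
  qed
  finally show "(INF t \<in> {t. matched_elimination_tree C t}. enat (depth t)) \<le> 2 * td G - 2" .
qed

end
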